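(* There exist $d\ge1$ and an IFS $\mathcal{F}=\{f_i\}_{i\in I}$ on the Euclidean space $\mathbb{R}^d$ consisting of similarities, satisfying the open set condition and whose contraction factors are not all equal, such that the attractor $K$ of $\mathcal{F}$, equipped with its natural fractal structure $\mathbf{\Gamma}$ as a self-similar set, satisfies $\dim_B(K)<\dim^2_{\mathbf{\Gamma}}(K)$ (both limits defining these dimensions existing).
   Context: IFS. An IFS on a metric space is a finite family $\mathcal{F}=\{f_i\}_{i\in I}$, $I=\{1,\dots,k\}$, of contractions (Lipschitz self-maps with constant $c_i<1$, called the contraction factor); a similarity with factor $c$ satisfies $\rho(f(x),f(y))=c\,\rho(x,y)$ for all $x,y$. Its attractor is the unique nonempty compact set $K$ with $K=\bigcup_{i\in I}f_i(K)$. The IFS of similarities on $\mathbb{R}^d$ satisfies the open set condition (OSC) if there is a nonempty bounded open set $V\subset\mathbb{R}^d$ such that $\bigcup_{i\in I}f_i(V)\subset V$, with this union disjoint. Natural fractal structure. The natural fractal structure on $K$ as a self-similar set is the sequence $\mathbf{\Gamma}=\{\Gamma_n\}_{n\in\mathbb{N}}$ of coverings $\Gamma_n=\{f_\omega(K):\omega\in I^n\}$ of $K$, where $f_\omega=f_{\omega_1}\circ\cdots\circ f_{\omega_n}$; each $\Gamma_n$ is regarded as a family indexed by $I^n$, so the same set may appear several times and elements are counted with multiplicity. Dimensions. $\dim_B(F)=\lim_{\delta\to0}\frac{\log N_\delta(F)}{-\log\delta}$ is the box dimension of $F\subseteq\mathbb{R}^d$, where $N_\delta(F)$ is the number of cubes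 $[k_1\delta,(k_1+1)\delta]\times\cdots\times[k_d\delta,(k_d+1)\delta]$, $k_i\in\mathbb{Z}$, meeting $F$. The fractal dimension II of $F\subseteq K$ is $\dim^2_{\mathbf{\Gamma}}(F)=\lim_{n\to\infty}\frac{\log N_n(F)}{-\log\delta(F,\Gamma_n)}$, where $N_n(F)$ is the number of elements of $\Gamma_n$ meeting $F$ and $\delta(F,\Gamma_n)=\sup\{\operatorname{diam}(A):A\in\Gamma_n,\ A\cap F\neq\emptyset\}$ (Euclidean diameter). *)

theory Defs
  imports "HOL-Analysis.Analysis"
begin

section \<open>Euclidean space of variable dimension\<close>

text \<open>
  The dimension \<open>d\<close> is existentially quantified in the main statement, so it cannot be a type.
  The space \<open>R^d\<close> is the carrier of the library's \<^const>\<open>Euclidean_space\<close>: the functions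
  \<open>nat \<Rightarrow> real\<close> that vanish from index \<open>d\<close> on.
\<close>

definition euclid :: "nat \<Rightarrow> (nat \<Rightarrow> real) metric" where
  "euclid d = metric (topspace (Euclidean_space d), \<lambda>x y. L2_set (\<lambda>i. x i - y i) {..<d})"

lemma Metric_space_euclid:
  "Metric_space (topspace (Euclidean_space d)) (\<lambda>x y. L2_set (\<lambda>i. x i - y i) {..<d})"
proof
  show "L2_set (\<lambda>i. x i - y i) {..<d} = L2_set (\<lambda>i. y i - x i) {..<d}" for x y :: "nat \<Rightarrow> real"
    by (simp add: L2_set_def power2_commute)
  show "L2_set (\<lambda>i. x i - y i) {..<d} = 0 \<longleftrightarrow> x = y"
    if "x \<in> topspace (Euclidean_space d)" "y \<in> topspace (Euclidean_space d)" for x y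
    using that by (auto simp: L2_set_eq_0_iff topspace_Euclidean_space fun_eq_iff) (metis lessThan_iff not_le)
  show "L2_set (\<lambda>i. x i - z i) {..<d}
      \<le> L2_set (\<lambda>i. x i - y i) {..<d} + L2_set (\<lambda>i. y i - z i) {..<d}" for x y z :: "nat \<Rightarrow> real"
    using L2_set_triangle_ineq[of "\<lambda>i. x i - y i" "\<lambda>i. y i - z i" "{..<d}"] by simp
qed simp

lemma mspace_euclid [simp]: "mspace (euclid d) = {x. \<forall>i\<ge>d. x i = 0}"
  unfolding euclid_def Metric_space.mspace_metric[OF Metric_space_euclid]
  by (rule topspace_Euclidean_space)

lemma mdist_euclid [simp]: "mdist (euclid d) = (\<lambda>x y. L2_set (\<lambda>i. x i - y i) {..<d})"
  unfolding euclid_def by (rule Metric_space.mdist_metric[OF Metric_space_euclid])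

lemma mtopology_of_euclid: "mtopology_of (euclid d) = Euclidean_space d"
proof -
  interpret E: Metric_space "topspace (Euclidean_space d)" "\<lambda>x y. L2_set (\<lambda>i. x i - y i) {..<d}"
    by (rule Metric_space_euclid)
  have mt: "mtopology_of (euclid d) = E.mtopology"
    unfolding euclid_def by (rule E.mtopology_of)
  have zero: "x i = 0" if "x \<in> topspace (Euclidean_space d)" "d \<le> i" for x i
    using that by (simp add: topspace_Euclidean_space)
  have coord: "continuous_map E.mtopology euclideanreal (\<lambda>x. x i)" for i
  proof (cases "i < d")
    case True
    show ?thesis
      unfolding continuous_map_def
    proof (intro conjI allI impI)
      fix U :: "real set" assume U: "openin euclideanreal U"
      show "openin E.mtopology {x \<in> topspace E.mtopology. x i \<in> U}"
        unfolding E.openin_mtopology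
      proof (intro conjI allI impI)
        fix x assume "x \<in> {x \<in> topspace E.mtopology. x i \<in> U}"
        then have "x i \<in> U" by simp
        then obtain e where e: "e > 0" "ball (x i) e \<subseteq> U"
          using U open_contains_ball by (metis open_openin)
        have "\<bar>x i - y i\<bar> \<le> L2_set (\<lambda>i. x i - y i) {..<d}" for y
          using member_le_L2_set[of "{..<d}" i "\<lambda>i. \<bar>x i - y i\<bar>"] True by (simp add: L2_set_def)
        then have "E.mball x e \<subseteq> {x \<in> topspace E.mtopology. x i \<in> U}"
          using e(2) by (auto simp: E.mball_def dist_real_def subset_iff intro: le_less_trans)
        then show "\<exists>r>0. E.mball x r \<subseteq> {x \<in> topspace E.mtopology. x i \<in> U}"
          using e(1) by blast
      qed auto
    qed auto
  next
    case False
    have "continuous_map E.mtopology euclideanreal (\<lambda>x. 0)" by simp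
    then show ?thesis
      by (rule continuous_map_eq) (use False zero in simp)
  qed
  have into: "continuous_map X (Euclidean_space d) id \<longleftrightarrow>
      (\<forall>i. continuous_map X euclideanreal (\<lambda>x. x i)) \<and> (\<forall>x\<in>topspace X. \<forall>i\<ge>d. x i = 0)" for X
    unfolding Euclidean_space_def continuous_map_in_subtopology
    by (simp add: continuous_map_componentwise_UNIV Pi_iff)
  have "continuous_map E.mtopology (Euclidean_space d) id"
    unfolding into using coord zero by simp
  then have 1: "openin E.mtopology U" if "openin (Euclidean_space d) U" for U
    using that openin_subset[OF that] openin_continuous_map_preimage[of E.mtopology _ id U]
    by (auto simp: Collect_conj_eq Int_absorb1)
  have ball: "openin (Euclidean_space d) (E.mball x r)" for x r
  proof (cases "x \<in> topspace (Euclidean_space d)")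
    case True
    have "continuous_map (Euclidean_space d) euclideanreal (\<lambda>y. L2_set (\<lambda>i. x i - y i) {..<d})"
      unfolding continuous_map_Euclidean_space_iff L2_set_def
      by (intro continuous_intros continuous_on_subset[OF continuous_on_product_coordinates]) auto
    from openin_continuous_map_preimage[OF this, of "{..<r}"] True show ?thesis
      by (simp add: E.mball_def)
  next
    case False
    then have "E.mball x r = {}" by (auto simp: E.mball_def)
    then show ?thesis by simp
  qed
  have 2: "openin (Euclidean_space d) U" if "openin E.mtopology U" for U
  proof (subst openin_subopen, intro ballI)
    fix x assume "x \<in> U"
    with that obtain r where "r > 0" "E.mball x r \<subseteq> U" "U \<subseteq> topspace (Euclidean_space d)"
      unfolding E.openin_mtopology by blast
    then show "\<exists>T. openin (Euclidean_space d) T \<and> x \<in> T \<and> T \<subseteq> U"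
      using ball \<open>x \<in> U\<close> by (intro exI[of _ "E.mball x r"]) (auto simp: L2_set_0')
  qed
  show ?thesis unfolding mt topology_eq using 1 2 by blast
qed


section \<open>Iterated function systems\<close>

text \<open>An IFS \<open>f\<close> is indexed by \<open>{1..k}\<close>; \<open>c i\<close> is the contraction factor of \<open>f i\<close>.\<close>

definition ifs :: "'a metric \<Rightarrow> nat \<Rightarrow> (nat \<Rightarrow> 'a \<Rightarrow> 'a) \<Rightarrow> (nat \<Rightarrow> real) \<Rightarrow> bool" where
  "ifs m k f c \<longleftrightarrow> 1 \<le> k \<and>
     (\<forall>i\<in>{1..k}. 0 \<le> c i \<and> c i < 1 \<and> f i \<in> mspace m \<rightarrow> mspace m \<and>
        (\<forall>x\<in>mspace m. \<forall>y\<in>mspace m. mdist m (f i x) (f i y) \<le> c i * mdist m x y))"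

text \<open>Similarities have a positive factor, i.e. constant maps are excluded.\<close>

definition similarity :: "'a metric \<Rightarrow> real \<Rightarrow> ('a \<Rightarrow> 'a) \<Rightarrow> bool" where
  "similarity m c g \<longleftrightarrow> 0 < c \<and> g \<in> mspace m \<rightarrow> mspace m \<and>
     (\<forall>x\<in>mspace m. \<forall>y\<in>mspace m. mdist m (g x) (g y) = c * mdist m x y)"

definition ifs_invariant :: "'a metric \<Rightarrow> nat \<Rightarrow> (nat \<Rightarrow> 'a \<Rightarrow> 'a) \<Rightarrow> 'a set \<Rightarrow> bool" where
  "ifs_invariant m k f K \<longleftrightarrow>
     K \<noteq> {} \<and> compactin (mtopology_of m) K \<and> K = (\<Union>i\<in>{1..k}. f i ` K)"

definition attractor :: "'a metric \<Rightarrow> nat \<Rightarrow> (nat \<Rightarrow> 'a \<Rightarrow> 'a) \<Rightarrow> 'a set \<Rightarrow> bool" where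
  "attractor m k f K \<longleftrightarrow> ifs_invariant m k f K \<and> (\<forall>L. ifs_invariant m k f L \<longrightarrow> L = K)"

definition open_set_condition :: "'a metric \<Rightarrow> nat \<Rightarrow> (nat \<Rightarrow> 'a \<Rightarrow> 'a) \<Rightarrow> bool" where
  "open_set_condition m k f \<longleftrightarrow>
     (\<exists>V. V \<noteq> {} \<and> openin (mtopology_of m) V \<and> Metric_space.mbounded (mspace m) (mdist m) V \<and>
        (\<Union>i\<in>{1..k}. f i ` V) \<subseteq> V \<and> disjoint_family_on (\<lambda>i. f i ` V) {1..k})"


section \<open>Fractal structures and fractal dimension II\<close>

text \<open>
  The \<open>n\<close>-th covering is a family indexed by a set \<open>W n\<close>, so that its elements are counted with
  multiplicity. For the natural fractal structure, \<open>W n\<close> is the set of words of length \<open>n\<close>.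
\<close>

definition words :: "nat \<Rightarrow> nat \<Rightarrow> nat list set" where
  "words k n = {w. length w = n \<and> set w \<subseteq> {1..k}}"

definition word_map :: "(nat \<Rightarrow> 'a \<Rightarrow> 'a) \<Rightarrow> nat list \<Rightarrow> 'a \<Rightarrow> 'a" where
  "word_map f w = foldr (\<lambda>i g. f i \<circ> g) w id"

definition natural_structure :: "(nat \<Rightarrow> 'a \<Rightarrow> 'a) \<Rightarrow> 'a set \<Rightarrow> nat \<Rightarrow> nat list \<Rightarrow> 'a set" where
  "natural_structure f K n w = word_map f w ` K"

text \<open>This is \<^const>\<open>diameter\<close> for a metric given as a value.\<close>

definition mdiameter :: "'a metric \<Rightarrow> 'a set \<Rightarrow> real" where
  "mdiameter m S = (if S = {} then 0 else SUP (x,y)\<in>S\<times>S. mdist m x y)"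

definition cover_count :: "'i set \<Rightarrow> ('i \<Rightarrow> 'a set) \<Rightarrow> 'a set \<Rightarrow> nat" where
  "cover_count J A F = card {j\<in>J. A j \<inter> F \<noteq> {}}"

definition cover_mesh :: "'a metric \<Rightarrow> 'i set \<Rightarrow> ('i \<Rightarrow> 'a set) \<Rightarrow> 'a set \<Rightarrow> real" where
  "cover_mesh m J A F = (SUP j\<in>{j\<in>J. A j \<inter> F \<noteq> {}}. mdiameter m (A j))"

definition has_fractal_dim2 ::
  "'a metric \<Rightarrow> (nat \<Rightarrow> 'i set) \<Rightarrow> (nat \<Rightarrow> 'i \<Rightarrow> 'a set) \<Rightarrow> 'a set \<Rightarrow> real \<Rightarrow> bool" where
  "has_fractal_dim2 m W \<Gamma> F t \<longleftrightarrow>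
     (\<lambda>n. ln (real (cover_count (W n) (\<Gamma> n) F)) / - ln (cover_mesh m (W n) (\<Gamma> n) F))
       \<longlonglongrightarrow> t"


section \<open>Box dimension\<close>

definition grid_cubes :: "nat \<Rightarrow> real \<Rightarrow> (nat \<Rightarrow> real) set set" where
  "grid_cubes d \<delta> = {C. \<exists>k :: nat \<Rightarrow> int. C =
     {x\<in>mspace (euclid d). \<forall>i<d. of_int (k i) * \<delta> \<le> x i \<and> x i \<le> (of_int (k i) + 1) * \<delta>}}"

definition box_count :: "nat \<Rightarrow> real \<Rightarrow> (nat \<Rightarrow> real) set \<Rightarrow> nat" where
  "box_count d \<delta> F = card {C\<in>grid_cubes d \<delta>. C \<inter> F \<noteq> {}}"

text \<open>Boundedness makes the set of cubes counted by \<open>box_count\<close> finite.\<close>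

definition has_box_dim :: "nat \<Rightarrow> (nat \<Rightarrow> real) set \<Rightarrow> real \<Rightarrow> bool" where
  "has_box_dim d F s \<longleftrightarrow>
     Metric_space.mbounded (mspace (euclid d)) (mdist (euclid d)) F \<and>
     ((\<lambda>\<delta>. ln (real (box_count d \<delta> F)) / - ln \<delta>) \<longlongrightarrow> s) (at_right 0)"

end

(* Since the fractal dimension II compares the number of cylinders of level n with the largest of
   their diameters, unequal contraction factors can make it exceed the box dimension. On the line,
   the maps t \<mapsto> 2t/3 and t \<mapsto> t/3 + 2/3 subdivide K = [0,1], which has box dimension 1; but level n
   has 2^n cylinders, the largest of length (2/3)^n, so that the fractal dimension II is
   ln 2 / ln (3/2) > 1. *)

theory Submission
  imports Defs "HOL-Real_Asymp.Real_Asymp"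
begin

section \<open>Words of similarities\<close>

lemma similarity_comp:
  assumes "similarity m a g" "similarity m b h"
  shows "similarity m (a * b) (g \<circ> h)"
  using assms unfolding similarity_def by (auto simp: Pi_iff)

lemma word_map_Nil [simp]: "word_map f [] = id"
  by (simp add: word_map_def)

lemma word_map_Cons [simp]: "word_map f (i # w) = f i \<circ> word_map f w"
  by (simp add: word_map_def)

lemma similarity_word_map:
  assumes "\<forall>i\<in>{1..k}. similarity m (c i) (f i)" "set w \<subseteq> {1..k}"
  shows "similarity m (prod_list (map c w)) (word_map f w)"
  using assms(2)
proof (induction w)
  case Nil
  show ?case by (simp add: similarity_def)
next
  case (Cons i w)
  then show ?case
    using similarity_comp[of m "c i" "f i" "prod_list (map c w)" "word_map f w"] assms(1)
    by (simp add: comp_def)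
qed

lemma word_map_image_subset:
  assumes "K = (\<Union>i\<in>{1..k}. f i ` K)" "set w \<subseteq> {1..k}"
  shows "word_map f w ` K \<subseteq> K"
  using assms(2)
proof (induction w)
  case (Cons i w)
  then have "f i ` (word_map f w ` K) \<subseteq> f i ` K" by (intro image_mono) simp
  also have "\<dots> \<subseteq> (\<Union>i\<in>{1..k}. f i ` K)" using Cons.prems by (intro UN_upper) simp
  also have "\<dots> = K" using assms(1) by (rule sym)
  finally show ?case by (simp add: image_comp)
qed simp

text \<open>All cylinders are nonempty subsets of \<open>K\<close>, so none is left out. The count
  runs over words, hence with multiplicity, even if two words give the same cylinder.\<close>

lemma cover_count_natural_structure:
  assumes "K = (\<Union>i\<in>{1..k}. f i ` K)" "K \<noteq> {}"
  shows "cover_count (words k n) (natural_structure f K n) K = k ^ n"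
proof -
  have "natural_structure f K n w \<inter> K \<noteq> {}" if "w \<in> words k n" for w
    using word_map_image_subset[OF assms(1), of w] that assms(2)
    by (auto simp: words_def natural_structure_def)
  then have "{w \<in> words k n. natural_structure f K n w \<inter> K \<noteq> {}} = words k n"
    by blast
  then show ?thesis
    using card_lists_length_eq[of "{1..k}" n]
    by (simp add: cover_count_def words_def conj_commute)
qed

text \<open>The hypothesis \<open>diam\<close> normalises \<open>K\<close> to diameter 1 (take the
  empty word). A product of n factors is largest when each of them is the largest factor
  \<open>c l\<close>.\<close>

lemma cover_mesh_natural_structure:
  assumes inv: "K = (\<Union>i\<in>{1..k}. f i ` K)" and ne: "K \<noteq> {}"
    and diam: "\<And>w. set w \<subseteq> {1..k} \<Longrightarrow> mdiameter m (word_map f w ` K) = prod_list (map c w)"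
    and c: "\<And>i. i \<in> {1..k} \<Longrightarrow> 0 \<le> c i \<and> c i \<le> c l" and l: "l \<in> {1..k}"
  shows "cover_mesh m (words k n) (natural_structure f K n) K = c l ^ n"
  unfolding cover_mesh_def
proof (rule cSup_eq_maximum)
  have le: "prod_list (map c w) \<le> c l ^ length w" if "set w \<subseteq> {1..k}" for w
    using that
  proof (induction w)
    case (Cons i w)
    have "0 \<le> c l" using c[OF l] by simp
    moreover have "0 \<le> c i" "c i \<le> c l" using c[of i] Cons.prems by auto
    moreover have "0 \<le> prod_list (map c w)"
      using Cons.prems c by (intro prod_list_nonneg) auto
    ultimately show ?case using Cons by (auto intro!: mult_mono)
  qed simp
  \<comment> \<open>The constant word in \<open>l\<close> attains the bound.\<close>
  have "replicate n l \<in> words k n" using l by (auto simp: words_def)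
  moreover have "word_map f (replicate n l) ` K \<inter> K \<noteq> {}"
    using word_map_image_subset[OF inv, of "replicate n l"] l ne by fastforce
  moreover have "mdiameter m (natural_structure f K n (replicate n l)) = c l ^ n"
    using diam[of "replicate n l"] l
    by (simp add: natural_structure_def prod_list_replicate set_replicate_conv_if)
  ultimately show "c l ^ n \<in> (\<lambda>w. mdiameter m (natural_structure f K n w)) `
      {w \<in> words k n. natural_structure f K n w \<inter> K \<noteq> {}}"
    by (intro image_eqI[of _ _ "replicate n l"]) (simp_all add: natural_structure_def)
  show "x \<le> c l ^ n" if "x \<in> (\<lambda>w. mdiameter m (natural_structure f K n w)) `
      {w \<in> words k n. natural_structure f K n w \<inter> K \<noteq> {}}" for x
    using that le diam by (auto simp: words_def natural_structure_def)
qed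

section \<open>The line as a Euclidean space of dimension one\<close>

text \<open>An isometry of the real line onto \<open>euclid 1\<close>; it carries questions about
  \<open>euclid 1\<close> over to sets of reals.\<close>

definition line :: "real \<Rightarrow> nat \<Rightarrow> real" where
  "line t = (\<lambda>i. if i = 0 then t else 0)"

lemma line_0 [simp]: "line t 0 = t"
  by (simp add: line_def)

lemma line_inject [simp]: "line s = line t \<longleftrightarrow> s = t"
  by (metis line_0)

lemma euclid_1_eq_range_line: "{x. \<forall>i\<ge>1. x i = 0} = range line"
proof (intro equalityI subsetI)
  fix x :: "nat \<Rightarrow> real" assume "x \<in> {x. \<forall>i\<ge>1. x i = 0}"
  then have "x = line (x 0)" by (auto simp: line_def fun_eq_iff Suc_le_eq)
  then show "x \<in> range line" by blast
qed (auto simp: line_def)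

lemma mspace_euclid_1: "mspace (euclid 1) = range line"
  using euclid_1_eq_range_line by simp

lemma mdist_line: "mdist (euclid 1) (line s) (line t) = \<bar>s - t\<bar>"
  by (simp add: L2_set_def)

lemma continuous_map_line: "continuous_map euclideanreal (Euclidean_space 1) line"
  unfolding Euclidean_space_def continuous_map_in_subtopology
  by (auto simp: continuous_map_componentwise_UNIV line_def)

lemma continuous_map_line_coordinate:
  "continuous_map (Euclidean_space 1) euclideanreal (\<lambda>x. x 0)"
  unfolding continuous_map_Euclidean_space_iff
  by (intro continuous_on_subset[OF continuous_on_product_coordinates]) auto

text \<open>\<open>line\<close> and the coordinate \<open>x 0\<close> are mutually inverse
  continuous maps, so compactness passes both ways. The forward direction serves the uniqueness of
  the attractor, where an arbitrary invariant compact set must be moved to the reals.\<close>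

lemma compactin_line_iff: "compactin (mtopology_of (euclid 1)) (line ` A) \<longleftrightarrow> compact A"
proof
  assume "compactin (mtopology_of (euclid 1)) (line ` A)"
  from image_compactin[OF this[unfolded mtopology_of_euclid] continuous_map_line_coordinate]
  show "compact A" by (simp add: image_image)
next
  assume "compact A"
  then show "compactin (mtopology_of (euclid 1)) (line ` A)"
    unfolding mtopology_of_euclid
    by (intro image_compactin[OF _ continuous_map_line]) simp
qed

lemma openin_line:
  assumes "open A"
  shows "openin (mtopology_of (euclid 1)) (line ` A)"
proof -
  have "line ` A = {x \<in> topspace (Euclidean_space 1). x 0 \<in> A}"
    unfolding topspace_Euclidean_space euclid_1_eq_range_line by auto
  then show ?thesis
    using openin_continuous_map_preimage[OF continuous_map_line_coordinate, of A] assms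
    by (simp add: mtopology_of_euclid)
qed

lemma mbounded_line:
  assumes "A \<subseteq> {0..1}"
  shows "Metric_space.mbounded (mspace (euclid 1)) (mdist (euclid 1)) (line ` A)"
  unfolding Metric_space.mbounded_def[OF Metric_space_mspace_mdist]
    Metric_space.mcball_def[OF Metric_space_mspace_mdist]
proof (intro exI subsetI)
  fix x assume "x \<in> line ` A"
  then show "x \<in> {y. line 0 \<in> mspace (euclid 1) \<and> y \<in> mspace (euclid 1) \<and>
      mdist (euclid 1) (line 0) y \<le> 1}"
    unfolding mspace_euclid_1 using assms by (auto simp: mdist_line simp del: mdist_euclid One_nat_def)
qed

lemma mdiameter_similar_unit_interval:
  assumes "similarity (euclid 1) r g"
  shows "mdiameter (euclid 1) (g ` line ` {0..1}) = r"
proof -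
  have r: "r > 0" "mdist (euclid 1) (g (line s)) (g (line t)) = r * \<bar>s - t\<bar>" for s t
    using assms unfolding similarity_def mspace_euclid_1 by (auto simp: mdist_line simp del: mdist_euclid One_nat_def)
  let ?S = "g ` line ` {0..1}"
  have "(SUP (x,y)\<in>?S\<times>?S. mdist (euclid 1) x y) = r"
  proof (rule cSup_eq_maximum)
    \<comment> \<open>All distances are scaled by \<open>r\<close>, so the supremum is attained at
      the images of the end points.\<close>
    have "r = mdist (euclid 1) (g (line 1)) (g (line 0))"
      unfolding r(2) by simp
    then show "r \<in> (\<lambda>(x,y). mdist (euclid 1) x y) ` (?S \<times> ?S)"
      by (intro image_eqI[of _ _ "(g (line 1), g (line 0))"]) auto
    fix z assume "z \<in> (\<lambda>(x,y). mdist (euclid 1) x y) ` (?S \<times> ?S)"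
    then obtain s t where "s \<in> {0..1}" "t \<in> {0..1}" "z = r * \<bar>s - t\<bar>"
      using r(2) by (auto simp del: mdist_euclid)
    moreover then have "\<bar>s - t\<bar> \<le> 1" by auto
    ultimately show "z \<le> r" using r(1) mult_left_mono[of "\<bar>s - t\<bar>" 1 r] by simp
  qed
  then show ?thesis by (simp add: mdiameter_def del: mdist_euclid)
qed

section \<open>Box dimension of the unit interval\<close>

lemma box_count_unit_interval:
  assumes "\<delta> > 0"
  shows "box_count 1 \<delta> (line ` {0..1}) = nat (\<lfloor>1 / \<delta>\<rfloor> + 2)"
proof -
  define C where "C k = line ` {of_int k * \<delta>..(of_int k + 1) * \<delta>}" for k :: int
  have "{x \<in> mspace (euclid 1). \<forall>i<1. of_int (k i) * \<delta> \<le> x i \<and> x i \<le> (of_int (k i) + 1) * \<delta>}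
      = C (k 0)" for k :: "nat \<Rightarrow> int"
    unfolding mspace_euclid_1 C_def by auto
  then have "grid_cubes 1 \<delta> = {D. \<exists>k :: nat \<Rightarrow> int. D = C (k 0)}"
    unfolding grid_cubes_def by simp
  \<comment> \<open>Index functions that agree at 0 describe the same cube; a constant function
    realises any given integer.\<close>
  also have "\<dots> = range C"
  proof (intro equalityI subsetI)
    fix D assume "D \<in> range C"
    then obtain j where "D = C j" by blast
    then show "D \<in> {D. \<exists>k :: nat \<Rightarrow> int. D = C (k 0)}"
      by (intro CollectI exI[of _ "\<lambda>_. j"])
  qed auto
  finally have grid: "grid_cubes 1 \<delta> = range C" .
  \<comment> \<open>\<open>box_count\<close> counts cubes as sets; injectivity, due to \<delta> > 0,
    lets the integers k be counted instead.\<close>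
  have inj: "inj C"
  proof (rule injI)
    fix j k assume "C j = C k"
    then have "{of_int j * \<delta>..(of_int j + 1) * \<delta>} = {of_int k * \<delta>..(of_int k + 1) * \<delta>}"
      unfolding C_def by (simp add: inj_image_eq_iff inj_def)
    then show "j = k" using assms by (auto simp: Icc_eq_Icc)
  qed
  \<comment> \<open>The cubes are closed, so the one with k = -1 counts: it touches the unit
    interval at 0. Together with the cubes from 0 up to the floor of 1/\<delta> this makes the floor
    plus 2.\<close>
  have meet: "C k \<inter> line ` {0..1} \<noteq> {} \<longleftrightarrow> k \<in> {-1..\<lfloor>1 / \<delta>\<rfloor>}" for k
  proof -
    have "C k \<inter> line ` {0..1} = line ` {max (of_int k * \<delta>) 0..min ((of_int k + 1) * \<delta>) 1}"
      unfolding C_def by (subst image_Int[symmetric]) (auto simp: inj_def)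
    \<comment> \<open>Two nonempty closed intervals meet exactly when each left end is at most the
      other's right end.\<close>
    then have "C k \<inter> line ` {0..1} \<noteq> {} \<longleftrightarrow> 0 \<le> (of_int k + 1) * \<delta> \<and> of_int k * \<delta> \<le> 1"
      using assms by (auto simp: algebra_simps)
    also have "\<dots> \<longleftrightarrow> k \<ge> -1 \<and> of_int k \<le> 1 / \<delta>"
    proof (intro arg_cong2[where f = "(\<and>)"])
      have "0 \<le> (of_int k + 1) * \<delta> \<longleftrightarrow> 0 \<le> real_of_int (k + 1)"
        using assms by (simp add: zero_le_mult_iff)
      also have "\<dots> \<longleftrightarrow> k \<ge> -1" unfolding of_int_0_le_iff by auto
      finally show "0 \<le> (of_int k + 1) * \<delta> \<longleftrightarrow> k \<ge> -1" .
    qed (use assms in \<open>simp add: field_simps\<close>)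
    finally show ?thesis by (simp add: le_floor_iff)
  qed
  have "{C' \<in> grid_cubes 1 \<delta>. C' \<inter> line ` {0..1} \<noteq> {}} = C ` {-1..\<lfloor>1 / \<delta>\<rfloor>}"
    unfolding grid using meet by blast
  then show ?thesis
    unfolding box_count_def by (simp add: card_image inj_on_subset[OF inj])
qed

text \<open>The count lies between 1/\<delta> and 1/\<delta> + 2, and the logarithms of both bounds
  are asymptotic to - ln \<delta>.\<close>

lemma has_box_dim_unit_interval: "has_box_dim 1 (line ` {0..1}) 1"
  unfolding has_box_dim_def
proof (intro conjI mbounded_line order_refl)
  \<comment> \<open>Below 1, - ln \<delta> is positive, so dividing by it keeps the
    inequalities.\<close>
  have pos: "eventually (\<lambda>\<delta>::real. 0 < \<delta> \<and> \<delta> < 1) (at_right 0)"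
    using eventually_at_right_real[of 0 1] by simp
  have bounds: "1 / \<delta> \<le> real (box_count 1 \<delta> (line ` {0..1}))"
      "real (box_count 1 \<delta> (line ` {0..1})) \<le> 1 / \<delta> + 2" if "0 < \<delta>" for \<delta>
  proof -
    have "0 \<le> \<lfloor>1 / \<delta>\<rfloor>" using that by simp
    then have "real (box_count 1 \<delta> (line ` {0..1})) = of_int \<lfloor>1 / \<delta>\<rfloor> + 2"
      unfolding box_count_unit_interval[OF that] by simp
    then show "1 / \<delta> \<le> real (box_count 1 \<delta> (line ` {0..1}))"
      "real (box_count 1 \<delta> (line ` {0..1})) \<le> 1 / \<delta> + 2"
      by linarith+
  qed
  show "((\<lambda>\<delta>. ln (real (box_count 1 \<delta> (line ` {0..1}))) / - ln \<delta>) \<longlongrightarrow> 1) (at_right 0)"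
  proof (rule tendsto_sandwich)
    show "((\<lambda>\<delta>::real. ln (1 / \<delta>) / - ln \<delta>) \<longlongrightarrow> 1) (at_right 0)"
      "((\<lambda>\<delta>::real. ln (1 / \<delta> + 2) / - ln \<delta>) \<longlongrightarrow> 1) (at_right 0)"
      by real_asymp+
    show "eventually (\<lambda>\<delta>. ln (1 / \<delta>) / - ln \<delta> \<le> ln (real (box_count 1 \<delta> (line ` {0..1}))) / - ln \<delta>)
        (at_right 0)"
      using pos
    proof eventually_elim
      case (elim \<delta>)
      then have "0 < 1 / \<delta>" "ln \<delta> < 0" by simp_all
      then show ?case using bounds(1)[of \<delta>] elim
        by (intro divide_right_mono ln_mono) auto
    qed
    show "eventually (\<lambda>\<delta>. ln (real (box_count 1 \<delta> (line ` {0..1}))) / - ln \<delta> \<le> ln (1 / \<delta> + 2) / - ln \<delta>)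
        (at_right 0)"
      using pos
    proof eventually_elim
      case (elim \<delta>)
      then have "0 < 1 / \<delta>" "ln \<delta> < 0" by simp_all
      moreover from this have "0 < real (box_count 1 \<delta> (line ` {0..1}))"
        using bounds(1)[of \<delta>] elim by linarith
      ultimately show ?case using bounds(2)[of \<delta>] elim
        by (intro divide_right_mono ln_mono) auto
    qed
  qed
qed

section \<open>Subdividing the unit interval in the ratio 2 : 1\<close>

lemma unit_interval_subdivision:
  "{0..1::real} = (\<lambda>t. 2/3 * t) ` {0..1} \<union> (\<lambda>t. 1/3 * t + 2/3) ` {0..1}"
proof -
  have "(\<lambda>t. 1/3 * t + 2/3) ` {0..1::real} = {2/3..1}"
    using image_affinity_atLeastAtMost[of "1/3::real" "2/3" 0 1] by simp
  moreover have "(\<lambda>t. 2/3 * t) ` {0..1::real} = {0..2/3}"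
    using image_mult_atLeastAtMost[of "2/3::real" 0 1] by simp
  ultimately show ?thesis by auto
qed

text \<open>The extremal points confine \<open>A\<close> to the unit interval. Conversely, iterated
  images of one point of \<open>A\<close> come arbitrarily close to every x in the unit interval,
  and \<open>A\<close> is closed.\<close>

lemma subdivision_invariant_compact_unique:
  fixes A :: "real set"
  assumes A: "compact A" "A \<noteq> {}" and inv: "A = (\<lambda>t. 2/3 * t) ` A \<union> (\<lambda>t. 1/3 * t + 2/3) ` A"
  shows "A = {0..1}"
proof
  have maps: "2/3 * a \<in> A" "1/3 * a + 2/3 \<in> A" if "a \<in> A" for a
    using that by (subst inv; blast)+
  have cases: "\<exists>b\<in>A. a = 2/3 * b \<or> a = 1/3 * b + 2/3" if "a \<in> A" for a
    using that by (subst (asm) inv) blast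
  obtain M where M: "M \<in> A" "\<And>a. a \<in> A \<Longrightarrow> a \<le> M"
    using compact_attains_sup[OF A] by blast
  obtain m where m: "m \<in> A" "\<And>a. a \<in> A \<Longrightarrow> m \<le> a"
    using compact_attains_inf[OF A] by blast
  \<comment> \<open>\<open>M\<close> is the image of some b \<le> M, so M \<le> 2/3 M or M \<le> 1/3
    M + 2/3, and either way M \<le> 1. The bound on \<open>m\<close> is dual.\<close>
  have "M \<le> 1"
    using cases[OF M(1)] M(2) M(2)[OF maps(2)[OF M(1)]] by fastforce
  moreover have "m \<ge> 0"
    using cases[OF m(1)] m(2) m(2)[OF maps(1)[OF m(1)]] by fastforce
  ultimately show "A \<subseteq> {0..1}"
    using M(2) m(2) by fastforce
  then obtain a0 where a0: "a0 \<in> A" "a0 \<in> {0..1}" using m(1) by blast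
  \<comment> \<open>Pull x back along a map whose image contains it, approximate the preimage and
    map forward: both maps multiply the error by at most 2/3. For n = 0 the bound is 1, which holds
    because \<open>a0\<close> and x both lie in the unit interval.\<close>
  have approx: "\<exists>a\<in>A. \<bar>a - x\<bar> \<le> (2/3) ^ n" if "x \<in> {0..1}" for x n
    using that
  proof (induction n arbitrary: x)
    case 0
    then show ?case using a0 by (intro bexI[of _ a0]) auto
  next
    case (Suc n)
    have "x \<in> (\<lambda>t. 2/3 * t) ` {0..1} \<union> (\<lambda>t. 1/3 * t + 2/3) ` {0..1}"
      using Suc.prems unfolding unit_interval_subdivision[symmetric] .
    then consider y where "y \<in> {0..1}" "x = 2/3 * y" | y where "y \<in> {0..1}" "x = 1/3 * y + 2/3"
      by blast
    then show ?case
    proof cases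
      case 1
      then obtain a where a: "a \<in> A" "\<bar>a - y\<bar> \<le> (2/3) ^ n" using Suc.IH by blast
      then have "\<bar>2/3 * a - x\<bar> \<le> (2/3) ^ Suc n" unfolding 1(2) by (simp add: abs_if split: if_splits)
      then show ?thesis using maps(1)[OF a(1)] by blast
    next
      case 2
      then obtain a where a: "a \<in> A" "\<bar>a - y\<bar> \<le> (2/3) ^ n" using Suc.IH by blast
      then have "\<bar>(1/3 * a + 2/3) - x\<bar> \<le> (2/3) ^ Suc n" unfolding 2(2) by (simp add: abs_if split: if_splits)
      then show ?thesis using maps(2)[OF a(1)] by blast
    qed
  qed
  show "{0..1} \<subseteq> A"
  proof
    fix x :: real assume x: "x \<in> {0..1}"
    have "x \<in> closure A"
      unfolding closure_approachable
    proof (intro allI impI)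
      fix e :: real assume "e > 0"
      then obtain n where "(2/3::real) ^ n < e"
        using real_arch_pow_inv[of e "2/3"] by auto
      then show "\<exists>a\<in>A. dist a x < e"
        using approx[OF x, of n] by (auto simp: dist_real_def intro: le_less_trans)
    qed
    then show "x \<in> A" using A(1) by (simp add: compact_imp_closed)
  qed
qed

section \<open>The two-map IFS on the line, its attractor and the open set condition\<close>

definition split_factor :: "nat \<Rightarrow> real" where
  "split_factor i = (if i = 1 then 2/3 else 1/3)"

text \<open>Every index other than 1 gets the second map, so that
  \<open>similarity_split_map\<close> holds for all i.\<close>

definition split_map :: "nat \<Rightarrow> (nat \<Rightarrow> real) \<Rightarrow> nat \<Rightarrow> real" where
  "split_map i x = line (split_factor i * x 0 + (if i = 1 then 0 else 2/3))"

lemma atLeast_1_atMost_2: "{1..2::nat} = {1, 2}"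
  by auto

lemma similarity_split_map: "similarity (euclid 1) (split_factor i) (split_map i)"
proof -
  have "mdist (euclid 1) (split_map i (line s)) (split_map i (line t))
      = split_factor i * mdist (euclid 1) (line s) (line t)" for s t
    unfolding split_map_def mdist_line
    by (simp add: split_factor_def abs_mult flip: right_diff_distrib diff_divide_distrib)
  then show ?thesis
    unfolding similarity_def mspace_euclid_1
    by (auto simp: split_map_def split_factor_def simp del: mdist_euclid)
qed

lemma split_map_image_line:
  "split_map 1 ` line ` A = line ` (\<lambda>t. 2/3 * t) ` A"
  "split_map 2 ` line ` A = line ` (\<lambda>t. 1/3 * t + 2/3) ` A"
  by (simp_all add: image_image split_map_def split_factor_def)

text \<open>Invariance and the open set condition thereby become statements about sets of
  reals.\<close>

lemma UN_split_map_line: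
  "(\<Union>i\<in>{1..2}. split_map i ` line ` A)
    = line ` ((\<lambda>t. 2/3 * t) ` A \<union> (\<lambda>t. 1/3 * t + 2/3) ` A)"
  unfolding atLeast_1_atMost_2 by (simp only: UN_insert split_map_image_line image_Un) simp

lemma unit_interval_split_invariant:
  "line ` {0..1} = (\<Union>i\<in>{1..2}. split_map i ` line ` {0..1})"
  unfolding UN_split_map_line unit_interval_subdivision[symmetric] ..

lemma attractor_split_map: "attractor (euclid 1) 2 split_map (line ` {0..1})"
  unfolding attractor_def
proof (intro conjI allI impI)
  show "ifs_invariant (euclid 1) 2 split_map (line ` {0..1})"
    unfolding ifs_invariant_def compactin_line_iff using unit_interval_split_invariant by simp
  fix L assume L: "ifs_invariant (euclid 1) 2 split_map L"
  \<comment> \<open>A compact set lies in the carrier, so every competitor \<open>L\<close> is the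
    image under \<open>line\<close> of some set \<open>A\<close> of reals; injectivity of
    \<open>line\<close> then transfers the invariance to \<open>A\<close>.\<close>
  then have "L \<subseteq> range line"
    using compactin_subset_topspace[of "mtopology_of (euclid 1)" L]
    unfolding ifs_invariant_def mtopology_of_euclid topspace_Euclidean_space euclid_1_eq_range_line
    by blast
  then obtain A where A: "L = line ` A" by (auto simp: subset_image_iff)
  have "line ` A = line ` ((\<lambda>t. 2/3 * t) ` A \<union> (\<lambda>t. 1/3 * t + 2/3) ` A)"
    using L unfolding ifs_invariant_def A UN_split_map_line by blast
  then have "A = (\<lambda>t. 2/3 * t) ` A \<union> (\<lambda>t. 1/3 * t + 2/3) ` A"
    by (subst (asm) inj_image_eq_iff) (auto simp: inj_def)
  then show "L = line ` {0..1}"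
    using subdivision_invariant_compact_unique[of A] L
    unfolding ifs_invariant_def A compactin_line_iff by blast
qed

text \<open>The open unit interval serves as V: its images are the open intervals from 0 to 2/3 and
  from 2/3 to 1, and the common end point 2/3 is in neither.\<close>

lemma open_set_condition_split_map: "open_set_condition (euclid 1) 2 split_map"
  unfolding open_set_condition_def
proof (intro exI conjI)
  show "openin (mtopology_of (euclid 1)) (line ` {0<..<1})" by (intro openin_line) simp
  show "Metric_space.mbounded (mspace (euclid 1)) (mdist (euclid 1)) (line ` {0<..<1})"
    by (intro mbounded_line) auto
  show "(\<Union>i\<in>{1..2}. split_map i ` line ` {0<..<1}) \<subseteq> line ` {0<..<1}"
    unfolding UN_split_map_line by (intro image_mono) auto
  have "split_map 1 ` line ` {0<..<1} \<inter> split_map 2 ` line ` {0<..<1} = {}"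
    unfolding split_map_image_line by auto
  then show "disjoint_family_on (\<lambda>i. split_map i ` line ` {0<..<1}) {1..2}"
    unfolding disjoint_family_on_def atLeast_1_atMost_2 by (auto simp: Int_commute)
qed simp

section \<open>Fractal dimension II of the attractor and conclusion\<close>

lemma has_fractal_dim2_split_map:
  "has_fractal_dim2 (euclid 1) (words 2) (natural_structure split_map (line ` {0..1}))
    (line ` {0..1}) (ln 2 / ln (3/2))"
proof -
  let ?K = "line ` {0..1}"
  have mesh: "cover_mesh (euclid 1) (words 2 n) (natural_structure split_map ?K n) ?K = (2/3) ^ n" for n
    using cover_mesh_natural_structure[OF unit_interval_split_invariant, of "euclid 1" split_factor 1 n]
      mdiameter_similar_unit_interval similarity_word_map[of 2 "euclid 1" split_factor split_map]
      similarity_split_map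
    by (simp add: split_factor_def)
  have count: "cover_count (words 2 n) (natural_structure split_map ?K n) ?K = 2 ^ n" for n
    using cover_count_natural_structure[OF unit_interval_split_invariant] by simp
  \<comment> \<open>At n = 0 both logarithms vanish and the quotient is 0 by the convention for
    division by 0; from n = 1 on it is constant.\<close>
  have "ln (real (2 ^ n)) / - ln ((2/3) ^ n) = ln 2 / ln (3/2 :: real)" if "n > 0" for n :: nat
    using that by (simp add: ln_realpow ln_div field_simps)
  then show ?thesis
    unfolding has_fractal_dim2_def mesh count
    by (intro tendsto_eventually eventually_mono[OF eventually_gt_at_top[of 0]]) auto
qed

theorem mainTheorem5:
  shows "\<exists>(d::nat) (k::nat) (f :: nat \<Rightarrow> (nat \<Rightarrow> real) \<Rightarrow> (nat \<Rightarrow> real)) (c :: nat \<Rightarrow> real)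
            (K :: (nat \<Rightarrow> real) set).
     d \<ge> 1 \<and>
     ifs (euclid d) k f c \<and>
     (\<forall>i\<in>{1..k}. similarity (euclid d) (c i) (f i)) \<and>
     open_set_condition (euclid d) k f \<and>
     (\<exists>i\<in>{1..k}. \<exists>j\<in>{1..k}. c i \<noteq> c j) \<and>
     attractor (euclid d) k f K \<and>
     (\<exists>s t. has_box_dim d K s \<and>
        has_fractal_dim2 (euclid d) (words k) (natural_structure f K) K t \<and>
        s < t)"
proof (intro exI conjI)
  show "ifs (euclid 1) 2 split_map split_factor"
    unfolding ifs_def using similarity_split_map
    by (auto simp: similarity_def split_factor_def simp del: mdist_euclid mspace_euclid)
  show "\<forall>i\<in>{1..2}. similarity (euclid 1) (split_factor i) (split_map i)"
    using similarity_split_map by blast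
  show "\<exists>i\<in>{1..2}. \<exists>j\<in>{1..2}. split_factor i \<noteq> split_factor j"
    by (auto simp: atLeast_1_atMost_2 split_factor_def)
  \<comment> \<open>Since 1 < 3/2 < 2, ln (3/2) is positive and smaller than ln 2.\<close>
  show "1 < ln 2 / ln (3/2 :: real)" by simp
qed (rule order_refl open_set_condition_split_map attractor_split_map has_box_dim_unit_interval
    has_fractal_dim2_split_map)+

end
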